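(* The transformation DL-Doubling (described in the context) transforms any diagonal $S_D$ of order $n$ into a straight line $S_L$ of order $n$ (all nodes in consecutive cells of one row or column) in $O(n\log n)$ line moves.
   Context: Nodes occupy distinct cells of the two-dimensional square grid, cells addressed by integer coordinates $(x,y)$. A shape is a finite set of nodes; its order is its number of nodes. A line is a set of one or more nodes occupying consecutive cells of one row or column. A line move (one step): a line of $k\ge1$ nodes occupying $(x_1,y),\dots,(x_1+k-1,y)$ may move right by one cell if $(x_1+k,y)$ is empty, or left by one cell if $(x_1-1,y)$ is empty; vertical lines move up/down analogously; all nodes move simultaneously. Connectivity need not be preserved. A diagonal of order $n$ is a shape with nodes at $(x+j,y+j)$, $j=0,\dots,n-1$. DL-Doubling: view the diagonal initially as $n$ lines of length 1. It proceeds in $\log n$ phases; at the start of phase $i$ there are $n/2^{i-1}$ lines of length $2^{i-1}$, labelled $1,2,3,\dots$ from top-right to bottom-left; odd-labelled ("free") lines move via a shortest path (turning as necessary) to merge with the next even-labelled ("stationary") line, which does not move, forming a line of double length in the stationary line's column (or row). After the last phase a single line of length $n$ remains. *)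

theory Defs
  imports Complex_Main "HOL-Library.Landau_Symbols"
begin

type_synonym cell = "int \<times> int"

text \<open>A shape is the finite set of the cells occupied by its nodes; nodes are anonymous.\<close>
type_synonym shape = "cell set"

definition hline :: "int \<Rightarrow> int \<Rightarrow> nat \<Rightarrow> cell set" where
  "hline x y k = {(x + int j, y) | j. j < k}"

definition vline :: "int \<Rightarrow> int \<Rightarrow> nat \<Rightarrow> cell set" where
  "vline x y k = {(x, y + int j) | j. j < k}"

definition is_line :: "cell set \<Rightarrow> bool" where
  "is_line L \<longleftrightarrow> (\<exists>x y k. k \<ge> 1 \<and> (L = hline x y k \<or> L = vline x y k))"

definition diagonal :: "int \<Rightarrow> int \<Rightarrow> nat \<Rightarrow> shape" where
  "diagonal x y n = {(x + int j, y + int j) | j. j < n}"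

definition is_diagonal :: "nat \<Rightarrow> shape \<Rightarrow> bool" where
  "is_diagonal n S \<longleftrightarrow> (\<exists>x y. S = diagonal x y n)"

text \<open>\<open>line_step S L L'\<close>: in the shape \<open>S\<close>, the line \<open>L\<close> may move by one cell, to \<open>L'\<close>.
  A line is any run of consecutive nodes, not necessarily a maximal one.\<close>
inductive line_step :: "shape \<Rightarrow> cell set \<Rightarrow> cell set \<Rightarrow> bool" for S where
  right: "\<lbrakk>k \<ge> 1; hline x y k \<subseteq> S; (x + int k, y) \<notin> S\<rbrakk>
            \<Longrightarrow> line_step S (hline x y k) (hline (x + 1) y k)"
| left: "\<lbrakk>k \<ge> 1; hline x y k \<subseteq> S; (x - 1, y) \<notin> S\<rbrakk>
            \<Longrightarrow> line_step S (hline x y k) (hline (x - 1) y k)"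
| up: "\<lbrakk>k \<ge> 1; vline x y k \<subseteq> S; (x, y + int k) \<notin> S\<rbrakk>
            \<Longrightarrow> line_step S (vline x y k) (vline x (y + 1) k)"
| down: "\<lbrakk>k \<ge> 1; vline x y k \<subseteq> S; (x, y - 1) \<notin> S\<rbrakk>
            \<Longrightarrow> line_step S (vline x y k) (vline x (y - 1) k)"

definition line_move :: "shape \<Rightarrow> shape \<Rightarrow> bool" where
  "line_move S S' \<longleftrightarrow> (\<exists>L L'. line_step S L L' \<and> S' = (S - L) \<union> L')"

text \<open>A line move of the whole shape \<open>S\<close> in which only nodes of the free set \<open>F\<close> take part;
  \<open>F'\<close> are the cells of these nodes afterwards. Moving a proper part of \<open>F\<close> is allowed:
  this is how a line turns.\<close>
definition free_move :: "shape \<times> cell set \<Rightarrow> shape \<times> cell set \<Rightarrow> bool" where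
  "free_move = (\<lambda>(S, F) (S', F').
     \<exists>L L'. line_step S L L' \<and> L \<subseteq> F \<and> S' = (S - L) \<union> L' \<and> F' = (F - L) \<union> L')"

text \<open>In \<open>m\<close> line moves the free line \<open>F\<close> travels to a line \<open>F'\<close> that prolongs the stationary
  line \<open>T\<close>. As moves only enter empty cells, \<open>F'\<close> and \<open>T\<close> stay disjoint, so the merged line lies
  in the column or row of \<open>T\<close> and its length is the sum of the two lengths.\<close>
definition merge_path ::
  "shape \<Rightarrow> cell set \<Rightarrow> cell set \<Rightarrow> nat \<Rightarrow> shape \<Rightarrow> cell set \<Rightarrow> bool" where
  "merge_path S F T m S' F' \<longleftrightarrow>
     (free_move ^^ m) (S, F) (S', F') \<and> is_line F' \<and> is_line (F' \<union> T)"

definition shortest_merge ::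
  "shape \<Rightarrow> cell set \<Rightarrow> cell set \<Rightarrow> nat \<Rightarrow> shape \<Rightarrow> cell set \<Rightarrow> bool" where
  "shortest_merge S F T m S' F' \<longleftrightarrow>
     merge_path S F T m S' F' \<and> (\<forall>m' S'' F''. merge_path S F T m' S'' F'' \<longrightarrow> m \<le> m')"

text \<open>\<open>dl_phase S Ls m S' Ls'\<close>: one phase, using \<open>m\<close> line moves in total, takes the shape \<open>S\<close> with
  the lines \<open>Ls\<close> to \<open>S'\<close> with the lines \<open>Ls'\<close>. The lists are ordered by label, that is, from
  top-right to bottom-left. If the number of lines is odd, the last one waits for the next
  phase; this never happens when the order of the diagonal is a power of two.\<close>
inductive dl_phase ::
  "shape \<Rightarrow> cell set list \<Rightarrow> nat \<Rightarrow> shape \<Rightarrow> cell set list \<Rightarrow> bool" where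
  none: "dl_phase S [] 0 S []"
| unpaired: "dl_phase S [L] 0 S [L]"
| pair: "\<lbrakk>shortest_merge S F T m S' F'; dl_phase S' Ls c S'' Ls'\<rbrakk>
           \<Longrightarrow> dl_phase S (F # T # Ls) (m + c) S'' ((F' \<union> T) # Ls')"

inductive dl_phases ::
  "nat \<Rightarrow> shape \<Rightarrow> cell set list \<Rightarrow> nat \<Rightarrow> shape \<Rightarrow> cell set list \<Rightarrow> bool" where
  zero: "dl_phases 0 S Ls 0 S Ls"
| Suc: "\<lbrakk>dl_phase S Ls m S' Ls'; dl_phases p S' Ls' c S'' Ls''\<rbrakk>
          \<Longrightarrow> dl_phases (Suc p) S Ls (m + c) S'' Ls''"

definition diagonal_lines :: "int \<Rightarrow> int \<Rightarrow> nat \<Rightarrow> cell set list" where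
  "diagonal_lines x y n = map (\<lambda>j. {(x + int j, y + int j)}) (rev [0..<n])"

text \<open>\<open>DL_Doubling n S m S'\<close>: some execution on the diagonal \<open>S\<close> of order \<open>n\<close> ends in \<open>S'\<close> after
  \<open>m\<close> line moves. Executions may differ in the choice among shortest paths; in particular two
  single nodes can merge in a column or in a row. The number of phases is \<open>log 2 n\<close> if \<open>n\<close> is a
  power of two.\<close>
definition DL_Doubling :: "nat \<Rightarrow> shape \<Rightarrow> nat \<Rightarrow> shape \<Rightarrow> bool" where
  "DL_Doubling n S m S' \<longleftrightarrow>
     (\<exists>x y Ls. S = diagonal x y n \<and>
        dl_phases (nat \<lceil>log 2 (real n)\<rceil>) S (diagonal_lines x y n) m S' Ls)"

end

theory Submission
  imports Defs
begin

text \<open>All lines between two phases are horizontal or vertical and fill consecutive blocks of the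
  original diagonal. So one merge moves a line \<open>F\<close> of length \<open>k\<close> whose bottom-left node is
  the cell diagonally next to the end of the block of a line \<open>T\<close> of length \<open>r\<close>; say that
  \<open>T\<close> is vertical. If \<open>F\<close> is horizontal, it slides left and turns up, in \<open>r + 2k - 2\<close> moves.
  If \<open>F\<close> is vertical, it cannot slide sideways: it either turns twice, in \<open>r + 3k - 3\<close>
  moves, or its nodes move one by one, in \<open>r k\<close> moves. Hence a merge takes at most
  \<open>3(k + r)\<close> moves and a phase at most \<open>3n\<close>.

  For this to go on, every shortest path must end above \<open>T\<close> and not below. Displacements
  suffice for that, except when both lines are vertical and \<open>r \<ge> 2\<close>. Then the moves are counted
  by the column of the cell that they vacate, and a path from column \<open>r\<close> to column \<open>0\<close> between
  disjoint sets of \<open>k\<close> rows takes at least \<open>3k + r - 2\<close> moves, one more than turning twice.\<close>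

section \<open>Squares and lines as sets of cells\<close>

definition box :: "int \<Rightarrow> int \<Rightarrow> nat \<Rightarrow> cell set" where
  "box x y n = {x..<x + int n} \<times> {y..<y + int n}"

text \<open>The orientation is left open because executions may differ in it; the bottom-left end
  and the length are all that the invariant fixes.\<close>

definition segment :: "int \<Rightarrow> int \<Rightarrow> nat \<Rightarrow> cell set \<Rightarrow> bool" where
  "segment x y k L \<longleftrightarrow> L = hline x y k \<or> L = vline x y k"

lemma mem_box [simp]:
  "(p, q) \<in> box x y n \<longleftrightarrow> x \<le> p \<and> p < x + int n \<and> y \<le> q \<and> q < y + int n"
  by (auto simp: box_def)

lemma mem_hline [simp]: "(p, q) \<in> hline x y k \<longleftrightarrow> q = y \<and> x \<le> p \<and> p < x + int k"
proof -
  have "\<exists>j<k. p = x + int j" if "x \<le> p" "p < x + int k"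
    using that by (intro exI[of _ "nat (p - x)"]) auto
  then show ?thesis by (auto simp: hline_def)
qed

lemma mem_vline [simp]: "(p, q) \<in> vline x y k \<longleftrightarrow> p = x \<and> y \<le> q \<and> q < y + int k"
proof -
  have "\<exists>j<k. q = y + int j" if "y \<le> q" "q < y + int k"
    using that by (intro exI[of _ "nat (q - y)"]) auto
  then show ?thesis by (auto simp: vline_def)
qed

lemma hline_eq_image: "hline x y k = (\<lambda>j. (x + int j, y)) ` {..<k}"
  by (auto simp: hline_def)

lemma vline_eq_image: "vline x y k = (\<lambda>j. (x, y + int j)) ` {..<k}"
  by (auto simp: vline_def)

lemma finite_hline [simp]: "finite (hline x y k)"
  by (simp add: hline_eq_image)

lemma finite_vline [simp]: "finite (vline x y k)"
  by (simp add: vline_eq_image)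

lemma card_hline [simp]: "card (hline x y k) = k"
  by (simp add: hline_eq_image card_image inj_on_def)

lemma card_vline [simp]: "card (vline x y k) = k"
  by (simp add: vline_eq_image card_image inj_on_def)

lemma segment_finite: "segment x y k L \<Longrightarrow> finite L"
  by (auto simp: segment_def)

lemma segment_card: "segment x y k L \<Longrightarrow> card L = k"
  by (auto simp: segment_def)

lemma segment_subset_box: "segment x y k L \<Longrightarrow> L \<subseteq> box x y k"
  by (auto simp: segment_def)

lemma segment_is_line: "segment x y k L \<Longrightarrow> 1 \<le> k \<Longrightarrow> is_line L"
  by (auto simp: segment_def is_line_def)

lemma hline_1: "hline x y (Suc 0) = {(x, y)}"
  by auto

lemma vline_1: "vline x y (Suc 0) = {(x, y)}"
  by auto

subsection \<open>Single moves\<close>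

lemma free_move_iff:
  "free_move (S, F) (S', F') \<longleftrightarrow>
     (\<exists>L L'. line_step S L L' \<and> L \<subseteq> F \<and> S' = (S - L) \<union> L' \<and> F' = (F - L) \<union> L')"
  by (simp add: free_move_def)

text \<open>As a set, a moved line only loses its trailing cell \<open>t\<close> and gains the cell
  \<open>h\<close> in front. The last clause has content only for left moves: crossing from column
  \<open>c + 1\<close> to \<open>c\<close> happens in one row, occupied in \<open>c + 1\<close>
  before and in \<open>c\<close> after the move.\<close>

lemma line_step_tail_head:
  assumes "line_step S L L'"
  obtains t h where "t \<in> L" "h \<notin> S" "L' = insert h (L - {t})"
    "\<And>c. fst h \<le> c \<Longrightarrow> c < fst t \<Longrightarrow>
       snd h = snd t \<and> (c + 1, snd t) \<in> L \<and> (c, snd t) \<in> L'"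
  using assms
proof cases
  case (right k x y)
  show ?thesis
    by (rule that[of "(x, y)" "(x + int k, y)"]) (use right in auto)
next
  case (left k x y)
  show ?thesis
    by (rule that[of "(x + int k - 1, y)" "(x - 1, y)"]) (use left in auto)
next
  case (up k x y)
  show ?thesis
    by (rule that[of "(x, y)" "(x, y + int k)"]) (use up in auto)
next
  case (down k x y)
  show ?thesis
    by (rule that[of "(x, y + int k - 1)" "(x, y - 1)"]) (use down in auto)
qed

lemma free_move_tail_head:
  assumes "free_move (S, F) (S', F')" "F \<subseteq> S"
  obtains t h where "t \<in> F" "h \<notin> S" "F' = insert h (F - {t})" "S' = insert h (S - {t})"
    "\<And>c. fst h \<le> c \<Longrightarrow> c < fst t \<Longrightarrow>
       snd h = snd t \<and> (c + 1, snd t) \<in> F \<and> (c, snd t) \<in> F'"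
proof -
  from assms obtain L L' where st: "line_step S L L'" and L: "L \<subseteq> F"
    and S': "S' = (S - L) \<union> L'" and F': "F' = (F - L) \<union> L'"
    by (auto simp: free_move_iff)
  from st obtain t h where th: "t \<in> L" "h \<notin> S" "L' = insert h (L - {t})"
    "\<And>c. fst h \<le> c \<Longrightarrow> c < fst t \<Longrightarrow>
       snd h = snd t \<and> (c + 1, snd t) \<in> L \<and> (c, snd t) \<in> L'"
    by (rule line_step_tail_head) blast
  show thesis
  proof (rule that[of t h])
    show "F' = insert h (F - {t})" "S' = insert h (S - {t})"
      using th L assms(2) F' S' by auto
    show "snd h = snd t \<and> (c + 1, snd t) \<in> F \<and> (c, snd t) \<in> F'"
      if "fst h \<le> c" "c < fst t" for c
      using th(4)[OF that] L F' by auto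
  qed (use th L in auto)
qed

lemma free_moves_invariant:
  assumes "(free_move ^^ m) (S, F) (S', F')" "F \<subseteq> S" "finite F"
  shows "F' \<subseteq> S' \<and> S' - F' = S - F \<and> finite F' \<and> card F' = card F \<and> (line_move ^^ m) S S'"
  using assms(1)
proof (induction m arbitrary: S' F')
  case 0
  then show ?case using assms by auto
next
  case (Suc m)
  then obtain S1 F1 where 1: "(free_move ^^ m) (S, F) (S1, F1)" "free_move (S1, F1) (S', F')"
    by auto
  note IH = Suc.IH[OF 1(1)]
  then obtain t h where th: "t \<in> F1" "h \<notin> S1" "F' = insert h (F1 - {t})" "S' = insert h (S1 - {t})"
    by (meson free_move_tail_head[OF 1(2)])
  have "S' - F' = S1 - F1" using th IH by auto
  moreover have "card F' = card F1"
    using th IH by (metis card_Suc_Diff1 card_insert_disjoint finite_Diff subset_iff Diff_iff)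
  moreover have "line_move S1 S'"
    using 1(2) by (auto simp: free_move_iff line_move_def)
  ultimately show ?case using th IH by auto
qed

lemma free_moveI:
  assumes "line_step (R \<union> F) L L'" "L \<subseteq> F" "R \<inter> F = {}" "F' = (F - L) \<union> L'"
  shows "free_move (R \<union> F, F) (R \<union> F', F')"
proof -
  have "R \<union> F' = (R \<union> F - L) \<union> L'" using assms by auto
  then show ?thesis using assms unfolding free_move_iff by blast
qed

subsection \<open>Displacement\<close>

definition near :: "nat \<Rightarrow> nat \<Rightarrow> nat \<Rightarrow> nat \<Rightarrow> cell \<Rightarrow> cell \<Rightarrow> bool" where
  "near l r u d c c' \<longleftrightarrow> fst c - int l \<le> fst c' \<and> fst c' \<le> fst c + int r \<and>
     snd c - int d \<le> snd c' \<and> snd c' \<le> snd c + int u"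

text \<open>Nodes are anonymous, so a two-sided matching, as in the Hausdorff distance, replaces a
  map from old to new cells. With one budget per direction, demands of different nodes in different
  directions can be added.\<close>

definition displaced :: "nat \<Rightarrow> nat \<Rightarrow> nat \<Rightarrow> nat \<Rightarrow> cell set \<Rightarrow> cell set \<Rightarrow> bool" where
  "displaced l r u d F F' \<longleftrightarrow>
     (\<forall>c\<in>F. \<exists>c'\<in>F'. near l r u d c c') \<and> (\<forall>c'\<in>F'. \<exists>c\<in>F. near l r u d c c')"

lemma displaced_refl: "displaced 0 0 0 0 F F"
  by (auto simp: displaced_def near_def)

lemma near_trans:
  "near l1 r1 u1 d1 a b \<Longrightarrow> near l2 r2 u2 d2 b c \<Longrightarrow>
     near (l1 + l2) (r1 + r2) (u1 + u2) (d1 + d2) a c"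
  by (auto simp: near_def)

lemma displaced_trans:
  "displaced l1 r1 u1 d1 A B \<Longrightarrow> displaced l2 r2 u2 d2 B C \<Longrightarrow>
     displaced (l1 + l2) (r1 + r2) (u1 + u2) (d1 + d2) A C"
  unfolding displaced_def by (meson near_trans)

lemma displaced_shift:
  assumes L': "L' = (\<lambda>c. (fst c + p, snd c + q)) ` L" and "L \<subseteq> F"
    and pq: "- int l \<le> p" "p \<le> int r" "- int d \<le> q" "q \<le> int u"
  shows "displaced l r u d F ((F - L) \<union> L')"
  unfolding displaced_def
proof (intro conjI ballI)
  fix c assume "c \<in> F"
  have "near l r u d c (fst c + p, snd c + q)" "near l r u d c c"
    using pq by (auto simp: near_def)
  then show "\<exists>c'\<in>F - L \<union> L'. near l r u d c c'"
    using \<open>c \<in> F\<close> L' by (cases "c \<in> L") auto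
next
  fix c' assume "c' \<in> F - L \<union> L'"
  have "near l r u d c (fst c + p, snd c + q)" "near l r u d c c" for c
    using pq by (auto simp: near_def)
  then show "\<exists>c\<in>F. near l r u d c c'"
    using \<open>c' \<in> F - L \<union> L'\<close> L' assms(2) by blast
qed

lemma hline_shift: "hline (x + p) (y + q) k = (\<lambda>c. (fst c + p, snd c + q)) ` hline x y k"
  by (simp add: hline_eq_image image_image algebra_simps)

lemma vline_shift: "vline (x + p) (y + q) k = (\<lambda>c. (fst c + p, snd c + q)) ` vline x y k"
  by (simp add: vline_eq_image image_image algebra_simps)

lemma free_move_displaced:
  assumes "free_move (S, F) (S', F')"
  shows "\<exists>l r u d. l + r + u + d = 1 \<and> displaced l r u d F F'"
proof -
  from assms obtain L L' where st: "line_step S L L'" and L: "L \<subseteq> F"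
    and F': "F' = (F - L) \<union> L'"
    by (auto simp: free_move_iff)
  from st show ?thesis
  proof cases
    case (right k x y)
    then have "displaced 0 1 0 0 F F'"
      unfolding F' using L hline_shift[of x 1 y 0 k]
      by (intro displaced_shift[where p=1 and q=0]) auto
    then show ?thesis
      by (intro exI[of _ 0] exI[of _ 1] conjI; simp)
  next
    case (left k x y)
    then have "displaced 1 0 0 0 F F'"
      unfolding F' using L hline_shift[of x "-1" y 0 k]
      by (intro displaced_shift[where p="-1" and q=0]) auto
    then show ?thesis
      by (intro exI[of _ 0] exI[of _ 1] conjI; simp)
  next
    case (up k x y)
    then have "displaced 0 0 1 0 F F'"
      unfolding F' using L vline_shift[of x 0 y 1 k]
      by (intro displaced_shift[where p=0 and q=1]) auto
    then show ?thesis
      by (intro exI[of _ 0] exI[of _ 1] conjI; simp)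
  next
    case (down k x y)
    then have "displaced 0 0 0 1 F F'"
      unfolding F' using L vline_shift[of x 0 y "-1" k]
      by (intro displaced_shift[where p=0 and q="-1"]) auto
    then show ?thesis
      by (intro exI[of _ 0] exI[of _ 1] conjI; simp)
  qed
qed

text \<open>Every move spends one unit of exactly one budget, so lower bounds on \<open>l\<close>
  and on \<open>d\<close> add up to a lower bound on \<open>m\<close>.\<close>

lemma free_moves_displaced:
  assumes "(free_move ^^ m) (S, F) (S', F')"
  obtains l r u d where "l + r + u + d = m" "displaced l r u d F F'"
proof -
  have "\<exists>l r u d. l + r + u + d = m \<and> displaced l r u d F F'"
    using assms
  proof (induction m arbitrary: S' F')
    case 0
    then show ?case using displaced_refl by auto
  next
    case (Suc m)
    then obtain S1 F1 where "(free_move ^^ m) (S, F) (S1, F1)" and 1: "free_move (S1, F1) (S', F')"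
      by auto
    then obtain l r u d where *: "l + r + u + d = m" "displaced l r u d F F1"
      using Suc.IH by blast
    obtain l' r' u' d' where "l' + r' + u' + d' = 1" "displaced l' r' u' d' F1 F'"
      using free_move_displaced[OF 1] by blast
    with * show ?case
      by (intro exI[of _ "l + l'"] exI[of _ "r + r'"] exI[of _ "u + u'"] exI[of _ "d + d'"])
        (auto intro: displaced_trans)
  qed
  then show thesis using that by blast
qed

subsection \<open>The counting bound\<close>

lemma free_moves_sequence:
  assumes "(free_move ^^ m) (S, F) (S', F')" "F \<subseteq> S" "finite F"
  obtains G t h where "G 0 = F" "G m = F'" "\<And>i. i \<le> m \<Longrightarrow> finite (G i)"
    "\<And>i. i < m \<Longrightarrow> t i \<in> G i" "\<And>i. i < m \<Longrightarrow> h i \<notin> G i"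
    "\<And>i. i < m \<Longrightarrow> G (Suc i) = insert (h i) (G i - {t i})"
    "\<And>i c. i < m \<Longrightarrow> fst (h i) \<le> c \<Longrightarrow> c < fst (t i) \<Longrightarrow>
       snd (h i) = snd (t i) \<and> (c + 1, snd (t i)) \<in> G i \<and> (c, snd (t i)) \<in> G (Suc i)"
proof -
  from assms(1) obtain f where f: "f 0 = (S, F)" "f m = (S', F')"
    "\<And>i. i < m \<Longrightarrow> free_move (f i) (f (Suc i))"
    unfolding relpowp_fun_conv by blast
  have path: "(free_move ^^ i) (f 0) (f i)" if "i \<le> m" for i
    unfolding relpowp_fun_conv using f(3) that by (intro exI[of _ f]) auto
  have inv: "snd (f i) \<subseteq> fst (f i) \<and> finite (snd (f i))" if "i \<le> m" for i
    using free_moves_invariant[of i S F "fst (f i)" "snd (f i)"] path[OF that] f(1) assms by auto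
  define good where "good i th \<longleftrightarrow> fst th \<in> snd (f i) \<and> snd th \<notin> snd (f i) \<and>
      snd (f (Suc i)) = insert (snd th) (snd (f i) - {fst th}) \<and>
      (\<forall>c. fst (snd th) \<le> c \<longrightarrow> c < fst (fst th) \<longrightarrow>
        snd (snd th) = snd (fst th) \<and> (c + 1, snd (fst th)) \<in> snd (f i) \<and>
        (c, snd (fst th)) \<in> snd (f (Suc i)))" for i and th :: "cell \<times> cell"
  have "\<exists>th. good i th" if "i < m" for i
  proof -
    have mv: "free_move (fst (f i), snd (f i)) (fst (f (Suc i)), snd (f (Suc i)))"
      using f(3)[OF that] by simp
    have sub: "snd (f i) \<subseteq> fst (f i)" using inv[of i] that by simp
    obtain t h where "t \<in> snd (f i)" "h \<notin> fst (f i)"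
      "snd (f (Suc i)) = insert h (snd (f i) - {t})"
      "\<And>c. fst h \<le> c \<Longrightarrow> c < fst t \<Longrightarrow>
         snd h = snd t \<and> (c + 1, snd t) \<in> snd (f i) \<and> (c, snd t) \<in> snd (f (Suc i))"
      by (rule free_move_tail_head[OF mv sub]) (rule that)
    then have "good i (t, h)"
      unfolding good_def using inv[of i] that by auto
    then show ?thesis ..
  qed
  then obtain th where th: "\<And>i. i < m \<Longrightarrow> good i (th i)"
    by metis
  show thesis
  proof (rule that[of "\<lambda>i. snd (f i)" "\<lambda>i. fst (th i)" "\<lambda>i. snd (th i)"])
    show "finite (snd (f i))" if "i \<le> m" for i using inv[OF that] by blast
  qed (use f(1,2) in simp, use f(1,2) in simp, use th in \<open>unfold good_def, blast+\<close>)
qed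

text \<open>Every link gains one: an element common to \<open>W s\<close> and
  \<open>W (Suc s)\<close> either lies in \<open>A\<close> and is counted in
  \<open>W s \<inter> A\<close>, which the next bound drops, or lies outside \<open>A\<close> and is
  a surplus of \<open>W (Suc s)\<close>. In the application \<open>W\<close> lists the rows used in
  the columns between start and target.\<close>

lemma sum_card_chain:
  fixes W :: "nat \<Rightarrow> 'a set"
  assumes "\<And>i. i \<le> s \<Longrightarrow> finite (W i)"
    and "\<And>i. i < s \<Longrightarrow> W i \<inter> W (Suc i) \<noteq> {}"
    and "A \<inter> B = {}"
  shows "card (W 0 \<inter> B) + card (W s \<inter> A) + s \<le> (\<Sum>i\<le>s. card (W i))"
  using assms(1,2)
proof (induction s)
  case 0
  have "card (W 0 \<inter> B) + card (W 0 \<inter> A) = card (W 0 \<inter> B \<union> W 0 \<inter> A)"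
    using 0 assms(3) by (subst card_Un_disjoint) auto
  also have "\<dots> \<le> card (W 0)"
    using 0 by (intro card_mono) auto
  finally show ?case by simp
next
  case (Suc s)
  have IH: "card (W 0 \<inter> B) + card (W s \<inter> A) + s \<le> (\<Sum>i\<le>s. card (W i))"
    using Suc by simp
  have fin: "finite (W s)" "finite (W (Suc s))" using Suc.prems(1) by auto
  obtain z where z: "z \<in> W s" "z \<in> W (Suc s)" using Suc.prems(2)[of s] by auto
  have "card (W (Suc s)) = card (W (Suc s) \<inter> A) + card (W (Suc s) - A)"
    using fin by (metis card_Int_Diff)
  moreover have "card (W s \<inter> A) > 0 \<or> card (W (Suc s) - A) > 0"
    using z fin by (cases "z \<in> A") (auto simp: card_gt_0_iff)
  ultimately show ?case using IH by auto
qed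

lemma ex_switch:
  fixes i m :: nat
  assumes "i \<le> m" "\<not> P i" "P m"
  obtains j where "i \<le> j" "j < m" "\<not> P j" "P (Suc j)"
proof -
  have "\<exists>j. i \<le> j \<and> j < m \<and> \<not> P j \<and> P (Suc j)"
  proof (rule ccontr)
    assume "\<not> ?thesis"
    with assms(1,2) have "\<not> P m" by (induction rule: dec_induct) auto
    with assms(3) show False by contradiction
  qed
  then show thesis using that by blast
qed

lemma card_less_Suc_Collect:
  "card {i. i < Suc m \<and> P i} = card {i. i < m \<and> P i} + (if P m then 1 else 0)"
proof -
  have "{i. i < Suc m \<and> P i} = {i. i < m \<and> P i} \<union> (if P m then {m} else {})"
    by (auto simp: less_Suc_eq)
  then show ?thesis by simp
qed

lemma potential_decrease:
  fixes f :: "nat \<Rightarrow> nat"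
  assumes "\<And>i. i < m \<Longrightarrow> f i \<le> f (Suc i) + (if P i then 1 else 0)"
  shows "f 0 \<le> f m + card {i. i < m \<and> P i}"
  using assms
proof (induction m)
  case (Suc m)
  then have "f 0 \<le> f m + card {i. i < m \<and> P i}" by simp
  with Suc.prems[of m] show ?case unfolding card_less_Suc_Collect by simp
qed simp

lemma potential_increase:
  fixes f :: "nat \<Rightarrow> nat"
  assumes "\<And>i. i < m \<Longrightarrow> f (Suc i) \<le> f i + (if P i then 1 else 0)"
  shows "f m \<le> f 0 + card {i. i < m \<and> P i}"
  using assms
proof (induction m)
  case (Suc m)
  then have "f m \<le> f 0 + card {i. i < m \<and> P i}" by simp
  with Suc.prems[of m] show ?case unfolding card_less_Suc_Collect by simp
qed simp

text \<open>Every move vacates exactly one cell, so the moves are counted by the column of that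
  cell. The potential on the columns from \<open>p\<close> on gives weight 1 only to the rows in which a
  node may leave these columns; a node elsewhere has weight 2, since it also has to change its
  row first.\<close>

lemma column_to_column_bound:
  fixes q :: int and s m :: nat
  defines "p \<equiv> q + int s + 2"
  assumes moves: "(free_move ^^ m) (S, F) (S', F')" and FS: "F \<subseteq> S" and "finite F"
    and F: "F = {p} \<times> A" and F': "F' = {q} \<times> B"
    and AB: "A \<inter> B = {}" and k: "card A = k" "card B = k" "1 \<le> k"
  shows "3 * k + s \<le> m"
proof -
  from moves FS \<open>finite F\<close> obtain G t h where G: "G 0 = F" "G m = F'"
      and fin: "\<And>i. i \<le> m \<Longrightarrow> finite (G i)"
      and t: "\<And>i. i < m \<Longrightarrow> t i \<in> G i" and h: "\<And>i. i < m \<Longrightarrow> h i \<notin> G i"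
      and Suc: "\<And>i. i < m \<Longrightarrow> G (Suc i) = insert (h i) (G i - {t i})"
      and cross: "\<And>i c. i < m \<Longrightarrow> fst (h i) \<le> c \<Longrightarrow> c < fst (t i) \<Longrightarrow>
         snd (h i) = snd (t i) \<and> (c + 1, snd (t i)) \<in> G i \<and> (c, snd (t i)) \<in> G (Suc i)"
    by (rule free_moves_sequence) (rule that)
  define V where "V c = {\<rho>. \<exists>i\<le>m. (c, \<rho>) \<in> G i}" for c
  have "V c \<subseteq> snd ` (\<Union>i\<in>{..m}. G i)" for c by (force simp: V_def)
  then have finV: "finite (V c)" for c
    by (rule finite_subset) (use fin in auto)
  have "0 < card A" "0 < card B" using k by linarith+
  then have finA: "finite A" "finite B" "A \<noteq> {}" "B \<noteq> {}"
    by (simp_all add: card_gt_0_iff)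

  \<comment> \<open>At first no node is in a column up to \<open>c\<close>, at the end all are. A
    move that changes none into some crosses to the left and puts its row into both sets.\<close>
  have meet: "V c \<inter> V (c + 1) \<noteq> {}" if c: "q \<le> c" "c < p" for c
  proof -
    let ?P = "\<lambda>i. \<exists>z\<in>G i. fst z \<le> c"
    have "\<not> ?P 0" "?P m" using finA c by (auto simp: G F F')
    then obtain i where i: "i < m" "\<not> ?P i" "?P (Suc i)"
      by (rule ex_switch[of 0 m ?P, OF le0])
    have "c < fst (t i)" using i(1,2) t by force
    moreover have "fst (h i) \<le> c" using i(2,3) unfolding Suc[OF i(1)] by auto
    ultimately have "snd (h i) = snd (t i) \<and> (c + 1, snd (t i)) \<in> G i \<and> (c, snd (t i)) \<in> G (Suc i)"
      using cross[OF i(1)] by blast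
    moreover have "i \<le> m" "Suc i \<le> m" using i(1) by auto
    ultimately have "snd (t i) \<in> V c \<inter> V (c + 1)"
      unfolding V_def by blast
    then show ?thesis by blast
  qed

  \<comment> \<open>Column \<open>c\<close> is empty at the end, so every cell used in it is vacated
    at some time, and distinct rows need distinct moves.\<close>
  have middle: "card (V c) \<le> card {i. i < m \<and> fst (t i) = c}" if c: "q < c" "c < p" for c
  proof -
    have "V c \<subseteq> (snd \<circ> t) ` {i. i < m \<and> fst (t i) = c}"
    proof
      fix \<rho> assume "\<rho> \<in> V c"
      then obtain i where i: "i \<le> m" "(c, \<rho>) \<in> G i" by (auto simp: V_def)
      have "(c, \<rho>) \<notin> G m" using G F' c by auto
      with i obtain j where "j < m" "(c, \<rho>) \<in> G j" "(c, \<rho>) \<notin> G (Suc j)"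
        using ex_switch[of i m "\<lambda>j. (c, \<rho>) \<notin> G j"] by auto
      then have "t j = (c, \<rho>)" using Suc by auto
      then show "\<rho> \<in> (snd \<circ> t) ` {i. i < m \<and> fst (t i) = c}"
        using \<open>j < m\<close> by (force simp: image_iff)
    qed
    then show ?thesis
      by (intro surj_card_le) auto
  qed

  have right: "2 * k \<le> card (V (p - 1) \<inter> A) + card {i. i < m \<and> p \<le> fst (t i)}"
  proof -
    define w where "w z = (if p \<le> fst z then if snd z \<in> V (p - 1) then 1 else 2 else 0 :: nat)"
      for z :: cell
    define \<phi> where "\<phi> X = (\<Sum>z\<in>X. w z)" for X
    have "\<phi> (G i) \<le> \<phi> (G (Suc i)) + (if p \<le> fst (t i) then 1 else 0)" if i: "i < m" for i
    proof -
      have f: "finite (G i)" using fin i by simp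
      have "\<phi> (G i) = w (t i) + \<phi> (G i - {t i})"
        unfolding \<phi>_def using sum.remove[OF f t[OF i]] by simp
      moreover have "\<phi> (G (Suc i)) = w (h i) + \<phi> (G i - {t i})"
        unfolding \<phi>_def Suc[OF i] using f h[OF i] by simp
      \<comment> \<open>A move out of these columns runs along a row of \<open>V (p - 1)\<close>, so
        the vacated cell has weight 1; a move within them changes weight 2 to 1 at best.\<close>
      moreover have "w (t i) \<le> w (h i) + (if p \<le> fst (t i) then 1 else 0)"
      proof (cases "p \<le> fst (t i) \<and> fst (h i) < p")
        case True
        then have "(p - 1, snd (t i)) \<in> G (Suc i)" using cross[OF i, of "p - 1"] by auto
        then have "snd (t i) \<in> V (p - 1)" using i unfolding V_def by (auto intro: exI[of _ "Suc i"])
        then show ?thesis using True by (auto simp: w_def)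
      qed (auto simp: w_def)
      ultimately show ?thesis by linarith
    qed
    from potential_decrease[of m "\<lambda>i. \<phi> (G i)" "\<lambda>i. p \<le> fst (t i)", OF this]
    have *: "\<phi> F \<le> \<phi> F' + card {i. i < m \<and> p \<le> fst (t i)}" using G by simp
    have "\<phi> F' = 0" unfolding \<phi>_def by (intro sum.neutral) (auto simp: w_def F' p_def)
    have "\<phi> F = (\<Sum>\<rho>\<in>A. w (p, \<rho>))"
      unfolding \<phi>_def F by (rule sum.reindex_cong[of "Pair p"]) (auto simp: inj_on_def)
    moreover have "(\<Sum>\<rho>\<in>A. w (p, \<rho>)) + card (V (p - 1) \<inter> A) = (\<Sum>\<rho>\<in>A. 2)"
    proof -
      have "card (V (p - 1) \<inter> A) = (\<Sum>\<rho>\<in>A. if \<rho> \<in> V (p - 1) then 1 else 0)"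
        using finA by (simp add: sum.If_cases Int_commute)
      then show ?thesis
        unfolding w_def by (simp only: sum.distrib[symmetric]) (intro sum.cong, auto)
    qed
    ultimately show ?thesis using * \<open>\<phi> F' = 0\<close> k by simp
  qed

  \<comment> \<open>Column \<open>q\<close> is entered from the right only in rows of
    \<open>V (q + 1)\<close>, which have weight 0. Weight is therefore gained only by moves that
    vacate a cell in a column up to \<open>q\<close>.\<close>
  have left: "k \<le> card (V (q + 1) \<inter> B) + card {i. i < m \<and> fst (t i) \<le> q}"
  proof -
    define w where "w z = (if fst z \<le> q \<and> snd z \<notin> V (q + 1) then 1 else 0 :: nat)" for z :: cell
    define \<phi> where "\<phi> X = (\<Sum>z\<in>X. w z)" for X
    have "\<phi> (G (Suc i)) \<le> \<phi> (G i) + (if fst (t i) \<le> q then 1 else 0)" if i: "i < m" for i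
    proof -
      have f: "finite (G i)" using fin i by simp
      have "\<phi> (G i) = w (t i) + \<phi> (G i - {t i})"
        unfolding \<phi>_def using sum.remove[OF f t[OF i]] by simp
      moreover have "\<phi> (G (Suc i)) = w (h i) + \<phi> (G i - {t i})"
        unfolding \<phi>_def Suc[OF i] using f h[OF i] by simp
      moreover have "w (h i) \<le> w (t i) + (if fst (t i) \<le> q then 1 else 0)"
      proof (cases "q < fst (t i) \<and> fst (h i) \<le> q")
        case True
        then have "(q + 1, snd (t i)) \<in> G i" "snd (h i) = snd (t i)" using cross[OF i, of q] by auto
        then have "snd (h i) \<in> V (q + 1)" using i unfolding V_def by (auto intro: exI[of _ i])
        then show ?thesis using True by (auto simp: w_def)
      qed (auto simp: w_def)
      ultimately show ?thesis by linarith
    qed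
    from potential_increase[of m "\<lambda>i. \<phi> (G i)" "\<lambda>i. fst (t i) \<le> q", OF this]
    have *: "\<phi> F' \<le> \<phi> F + card {i. i < m \<and> fst (t i) \<le> q}" using G by simp
    have "\<phi> F = 0" unfolding \<phi>_def by (intro sum.neutral) (auto simp: w_def F p_def)
    have "\<phi> F' = (\<Sum>\<rho>\<in>B. w (q, \<rho>))"
      unfolding \<phi>_def F' by (rule sum.reindex_cong[of "Pair q"]) (auto simp: inj_on_def)
    moreover have "(\<Sum>\<rho>\<in>B. w (q, \<rho>)) + card (V (q + 1) \<inter> B) = (\<Sum>\<rho>\<in>B. 1)"
    proof -
      have "card (V (q + 1) \<inter> B) = (\<Sum>\<rho>\<in>B. if \<rho> \<in> V (q + 1) then 1 else 0)"
        using finA by (simp add: sum.If_cases Int_commute)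
      then show ?thesis
        unfolding w_def by (simp only: sum.distrib[symmetric]) (intro sum.cong, auto)
    qed
    ultimately show ?thesis using * \<open>\<phi> F = 0\<close> k by simp
  qed

  \<comment> \<open>The \<open>s + 1\<close> columns strictly between are \<open>q + 1\<close> to
    \<open>p - 1\<close>. The two intersections that the chain bound provides make up for those in
    \<open>left\<close> and \<open>right\<close>, so \<open>2 * k + k + s\<close> remains.\<close>
  define C where "C j = {i. i < m \<and> fst (t i) = q + 1 + int j}" for j :: nat
  have "card (V (q + 1) \<inter> B) + card (V (p - 1) \<inter> A) + s \<le> (\<Sum>j\<le>s. card (V (q + 1 + int j)))"
    using sum_card_chain[of s "\<lambda>j. V (q + 1 + int j)" A B] finV AB
      meet[of "q + 1 + int j" for j]
    by (simp add: p_def algebra_simps)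
  also have "\<dots> \<le> (\<Sum>j\<le>s. card (C j))"
    unfolding C_def by (intro sum_mono middle) (auto simp: p_def)
  also have "\<dots> = card (\<Union>j\<le>s. C j)"
    by (subst card_UN_disjoint) (auto simp: C_def)
  finally have mid: "card (V (q + 1) \<inter> B) + card (V (p - 1) \<inter> A) + s \<le> card (\<Union>j\<le>s. C j)" .
  have "card {i. i < m \<and> fst (t i) \<le> q} + card {i. i < m \<and> p \<le> fst (t i)} + card (\<Union>j\<le>s. C j) =
      card ({i. i < m \<and> fst (t i) \<le> q} \<union> {i. i < m \<and> p \<le> fst (t i)} \<union> (\<Union>j\<le>s. C j))"
    by (subst card_Un_disjoint; (subst card_Un_disjoint)?) (auto simp: C_def p_def)
  also have "\<dots> \<le> card {..<m}"
    by (intro card_mono) (auto simp: C_def)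
  finally show ?thesis using left right mid by simp
qed

subsection \<open>Paths that merge above a vertical line\<close>

text \<open>A line on its way around two corners: \<open>h\<close> nodes still in column \<open>c\<close>, \<open>w\<close> nodes in row
  \<open>z\<close> from column \<open>a\<close> on, and \<open>u\<close> nodes already in the target column \<open>x\<close>.\<close>

definition snake :: "int \<Rightarrow> int \<Rightarrow> int \<Rightarrow> nat \<Rightarrow> int \<Rightarrow> nat \<Rightarrow> nat \<Rightarrow> cell set" where
  "snake x z c u a w h = vline x (z + 1) u \<union> hline a z w \<union> vline c (z + 1) h"

text \<open>The potential \<open>i + 2 * w + 3 * h\<close> drops by one per move and is 2 on
  arrival. Pulling column \<open>c\<close> down turns a 3 into a 2, sliding left lowers
  \<open>i\<close>, and pushing up removes a node from the row but resets \<open>i\<close> from 0 to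
  1. While column \<open>c\<close> holds nodes, the row ends either just left of it, leaving room to
  pull down, or right below it.\<close>

lemma snake_moves:
  fixes i w h u :: nat
  assumes "1 \<le> w" "x < c" "u + w + h = k"
    and "h = 0 \<or> x + int i + int w = c \<or> x + int i + int w = c + 1"
    and "c < e" "x + int i + int w \<le> e"
    and R: "R \<inter> {x..<e} \<times> {z..<z + int k} = {}"
    and n: "n + 2 = i + 2 * w + 3 * h"
  shows "(free_move ^^ n) (R \<union> snake x z c u (x + int i) w h, snake x z c u (x + int i) w h)
           (R \<union> vline x z k, vline x z k)"
  using assms(1-6) n
proof (induction n arbitrary: i w h u)
  case 0
  then have "w = 1" "h = 0" "i = 0" "k = Suc u" by auto
  then have "snake x z c u (x + int i) w h = vline x z k"
    by (auto simp: snake_def)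
  then show ?case by simp
next
  case (Suc n)
  let ?F = "snake x z c u (x + int i) w h"
  have disj: "R \<inter> ?F = {}"
    using R Suc.prems by (fastforce simp: snake_def)
  have free: "(p, q) \<notin> R" if "x \<le> p" "p < e" "z \<le> q" "q < z + int k" for p q
    using R that by auto
  consider (down) h' where "h = Suc h'" "x + int i + int w = c"
    | (left) i' where "i = Suc i'" "h = 0 \<or> x + int i + int w = c + 1"
    | (up) w' where "i = 0" "w = Suc w'" "1 \<le> w'"
      "h = 0 \<or> x + int i + int w = c + 1"
    using Suc.prems by (cases h; cases i; cases w) force+
  then show ?case
  proof cases
    case down
    have "line_step (R \<union> ?F) (vline c (z + 1) h) (vline c (z + 1 - 1) h)"
    proof (rule line_step.down)
      show "(c, z + 1 - 1) \<notin> R \<union> ?F"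
        using free[of c z] Suc.prems down by (auto simp: snake_def)
    qed (use down in \<open>auto simp: snake_def\<close>)
    then have "free_move (R \<union> ?F, ?F)
        (R \<union> snake x z c u (x + int i) (Suc w) h', snake x z c u (x + int i) (Suc w) h')"
      by (rule free_moveI) (use disj down Suc.prems in \<open>auto simp: snake_def\<close>)
    moreover have "(free_move ^^ n)
        (R \<union> snake x z c u (x + int i) (Suc w) h', snake x z c u (x + int i) (Suc w) h')
        (R \<union> vline x z k, vline x z k)"
      by (rule Suc.IH) (use down Suc.prems in auto)
    ultimately show ?thesis by (rule relpowp_Suc_I2)
  next
    case left
    have eq: "x + int i - 1 = x + int i'" using left by simp
    have "line_step (R \<union> ?F) (hline (x + int i) z w) (hline (x + int i - 1) z w)"
    proof (rule line_step.left)
      show "(x + int i - 1, z) \<notin> R \<union> ?F"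
        using free[of "x + int i - 1" z] Suc.prems left by (auto simp: snake_def)
    qed (use Suc.prems in \<open>auto simp: snake_def\<close>)
    then have "free_move (R \<union> ?F, ?F)
        (R \<union> snake x z c u (x + int i') w h, snake x z c u (x + int i') w h)"
      unfolding eq
      by (rule free_moveI) (use disj left Suc.prems in \<open>auto simp: snake_def\<close>)
    moreover have "(free_move ^^ n)
        (R \<union> snake x z c u (x + int i') w h, snake x z c u (x + int i') w h)
        (R \<union> vline x z k, vline x z k)"
      by (rule Suc.IH) (use left Suc.prems in auto)
    ultimately show ?thesis by (rule relpowp_Suc_I2)
  next
    case up
    \<comment> \<open>The corner node \<open>(x, z)\<close> moves together with the \<open>u\<close>
      nodes above it; the remaining row starts at \<open>x + 1\<close>.\<close>
    have "line_step (R \<union> ?F) (vline x z (Suc u)) (vline x (z + 1) (Suc u))"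
    proof (rule line_step.up)
      show "(x, z + int (Suc u)) \<notin> R \<union> ?F"
        using free[of x "z + int (Suc u)"] Suc.prems up by (auto simp: snake_def)
    qed (use Suc.prems up in \<open>auto simp: snake_def\<close>)
    then have "free_move (R \<union> ?F, ?F)
        (R \<union> snake x z c (Suc u) (x + int 1) w' h, snake x z c (Suc u) (x + int 1) w' h)"
      by (rule free_moveI) (use disj up Suc.prems in \<open>auto simp: snake_def\<close>)
    moreover have "(free_move ^^ n)
        (R \<union> snake x z c (Suc u) (x + int 1) w' h, snake x z c (Suc u) (x + int 1) w' h)
        (R \<union> vline x z k, vline x z k)"
      by (rule Suc.IH) (use up Suc.prems in auto)
    ultimately show ?thesis by (rule relpowp_Suc_I2)
  qed
qed

lemma single_node_moves_left:
  assumes "\<And>p. x \<le> p \<Longrightarrow> p < x + int r \<Longrightarrow> (p, q) \<notin> R \<union> F"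
    and "R \<inter> insert (x + int r, q) F = {}" "(x + int r, q) \<notin> F"
  shows "(free_move ^^ r) (R \<union> insert (x + int r, q) F, insert (x + int r, q) F)
           (R \<union> insert (x, q) F, insert (x, q) F)"
  using assms
proof (induction r)
  case (Suc r)
  let ?F = "insert (x + int (Suc r), q) F"
  have "line_step (R \<union> ?F) (hline (x + int (Suc r)) q 1) (hline (x + int (Suc r) - 1) q 1)"
    by (rule line_step.left) (use Suc.prems(1)[of "x + int r"] in auto)
  then have "free_move (R \<union> ?F, ?F)
      (R \<union> insert (x + int r, q) F, insert (x + int r, q) F)"
    by (rule free_moveI) (use Suc.prems in \<open>auto simp: hline_1\<close>)
  moreover have "(free_move ^^ r) (R \<union> insert (x + int r, q) F, insert (x + int r, q) F)
      (R \<union> insert (x, q) F, insert (x, q) F)"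
    using Suc.prems(1)[of "x + int r"] Suc.prems by (intro Suc.IH) auto
  ultimately show ?case by (rule relpowp_Suc_I2)
qed simp

text \<open>A single node is also a horizontal line, so it can slide through its own empty row,
  whatever the nodes above and below it do.\<close>

lemma column_moves_left_by_nodes:
  assumes R: "R \<inter> {x..x + int r} \<times> {z..<z + int k} = {}" and "1 \<le> r" and "j \<le> k"
  shows "(free_move ^^ (j * r)) (R \<union> vline (x + int r) z k, vline (x + int r) z k)
     (R \<union> (vline x z j \<union> vline (x + int r) (z + int j) (k - j)),
      vline x z j \<union> vline (x + int r) (z + int j) (k - j))"
  using \<open>j \<le> k\<close>
proof (induction j)
  case 0
  have "vline x z 0 = {}" by auto
  then show ?case by simp
next
  case (Suc j)
  let ?G = "vline x z j \<union> vline (x + int r) (z + int (Suc j)) (k - Suc j)"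
  have 1: "vline x z j \<union> vline (x + int r) (z + int j) (k - j) =
      insert (x + int r, z + int j) ?G"
    using Suc.prems by auto
  have 2: "vline x z (Suc j) \<union> vline (x + int r) (z + int (Suc j)) (k - Suc j) =
      insert (x, z + int j) ?G"
    by auto
  have "(free_move ^^ r)
      (R \<union> insert (x + int r, z + int j) ?G, insert (x + int r, z + int j) ?G)
      (R \<union> insert (x, z + int j) ?G, insert (x, z + int j) ?G)"
    using R Suc.prems \<open>1 \<le> r\<close> by (intro single_node_moves_left) (fastforce+)
  with Suc show ?case
    unfolding 1 2 mult_Suc add.commute[of r] relpowp_add by auto
qed

lemma merge_path_above:
  assumes S: "S \<inter> box x y (k + r) = F \<union> vline x y r" and kr: "1 \<le> k" "1 \<le> r"
    and F: "F \<subseteq> {z. y + int r \<le> snd z}"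
    and "(free_move ^^ m) ((S - F) \<union> F, F) ((S - F) \<union> vline x (y + int r) k, vline x (y + int r) k)"
  shows "merge_path S F (vline x y r) m ((S - F) \<union> vline x (y + int r) k) (vline x (y + int r) k)"
proof -
  have "(S - F) \<union> F = S" using S by auto
  moreover have "vline x (y + int r) k \<union> vline x y r = vline x y (k + r)" by auto
  ultimately show ?thesis
    using assms unfolding merge_path_def is_line_def by (metis add_leD1 trans_le_add1)
qed

lemma target_region_free:
  assumes "S \<inter> box x y (k + r) = F \<union> vline x y r"
  shows "(S - F) \<inter> {x..<x + int (k + r)} \<times> {y + int r..<y + int r + int k} = {}"
proof -
  have "(p, q) \<in> F" if "(p, q) \<in> S" "x \<le> p" "p < x + int (k + r)"
    "y + int r \<le> q" "q < y + int r + int k" for p q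
  proof -
    have "(p, q) \<in> F \<union> vline x y r"
      unfolding assms[symmetric] using that by simp
    then show ?thesis using that by simp
  qed
  then show ?thesis by auto
qed

text \<open>Both lengths are needed as upper bounds on a shortest merge: \<open>k * r\<close> rules
  out other endings when \<open>r = 1\<close>, the two-turn path when
  \<open>r \<ge> 2\<close>.\<close>

lemma merge_path_vertical:
  assumes S: "S \<inter> box x y (k + r) = F \<union> vline x y r" and kr: "1 \<le> k" "1 \<le> r"
    and F: "F = vline (x + int r) (y + int r) k"
  shows "\<exists>S' F'. merge_path S F (vline x y r) (k * r) S' F'"
    and "\<exists>S' F'. merge_path S F (vline x y r) (3 * k + r - 3) S' F'"
proof -
  let ?R = "S - F" and ?z = "y + int r"
  have R: "?R \<inter> {x..<x + int (k + r)} \<times> {?z..<?z + int k} = {}"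
    by (rule target_region_free[OF S])
  have "(free_move ^^ (k * r)) (?R \<union> F, F)
      (?R \<union> (vline x ?z k \<union> vline (x + int r) (?z + int k) (k - k)),
       vline x ?z k \<union> vline (x + int r) (?z + int k) (k - k))"
    using R kr unfolding F by (intro column_moves_left_by_nodes) fastforce+
  moreover have "vline (x + int r) (?z + int k) (k - k) = {}" by auto
  ultimately show "\<exists>S' F'. merge_path S F (vline x y r) (k * r) S' F'"
    using merge_path_above[OF S kr, of "k * r"] F by fastforce
  \<comment> \<open>The bottom node counts as a row of length 1 directly below the other
    \<open>k - 1\<close>; the potential is then \<open>r + 2 + 3 * (k - 1)\<close>.\<close>
  have "snake x ?z (x + int r) 0 (x + int r) 1 (k - 1) = F"
    unfolding F snake_def using kr by auto
  moreover have "(free_move ^^ (3 * k + r - 3))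
      (?R \<union> snake x ?z (x + int r) 0 (x + int r) 1 (k - 1),
       snake x ?z (x + int r) 0 (x + int r) 1 (k - 1)) (?R \<union> vline x ?z k, vline x ?z k)"
    using R kr by (intro snake_moves) auto
  ultimately show "\<exists>S' F'. merge_path S F (vline x y r) (3 * k + r - 3) S' F'"
    using merge_path_above[OF S kr, of "3 * k + r - 3"] F by fastforce
qed

lemma merge_path_horizontal:
  assumes S: "S \<inter> box x y (k + r) = F \<union> vline x y r" and kr: "1 \<le> k" "1 \<le> r"
    and F: "F = hline (x + int r) (y + int r) k"
  shows "\<exists>S' F'. merge_path S F (vline x y r) (2 * k + r - 2) S' F'"
proof -
  let ?R = "S - F" and ?z = "y + int r"
  have R: "?R \<inter> {x..<x + int (k + r)} \<times> {?z..<?z + int k} = {}"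
    by (rule target_region_free[OF S])
  have "snake x ?z (x + int r) 0 (x + int r) k 0 = F"
    unfolding F snake_def by auto
  moreover have "(free_move ^^ (2 * k + r - 2))
      (?R \<union> snake x ?z (x + int r) 0 (x + int r) k 0,
       snake x ?z (x + int r) 0 (x + int r) k 0) (?R \<union> vline x ?z k, vline x ?z k)"
    using R kr by (intro snake_moves) auto
  ultimately show ?thesis
    using merge_path_above[OF S kr, of "2 * k + r - 2"] F by fastforce
qed

subsection \<open>Shortest merges\<close>

lemma shortest_merge_le:
  "shortest_merge S F T m S' F' \<Longrightarrow> \<exists>S' F'. merge_path S F T c S' F' \<Longrightarrow> m \<le> c"
  unfolding shortest_merge_def by blast

lemma merge_path_imp_shortest:
  assumes "\<exists>S' F'. merge_path S F T c S' F'"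
  shows "\<exists>m S' F'. shortest_merge S F T m S' F'"
proof -
  let ?P = "\<lambda>m. \<exists>S' F'. merge_path S F T m S' F'"
  have "?P (LEAST m. ?P m)" using assms by (rule LeastI)
  moreover have "(LEAST m. ?P m) \<le> m" if "?P m" for m using that by (rule Least_le)
  ultimately show ?thesis unfolding shortest_merge_def by blast
qed

text \<open>Few endings make \<open>F' \<union> vline x y r\<close> a line, and each one that misses
  the block costs more than a path constructed above. For \<open>r = 1\<close> only vertical
  \<open>F\<close> is treated, since a single node is also horizontal and exchanging the axes covers
  the rest.\<close>

lemma shortest_merge_vertical:
  assumes S: "S \<inter> box x y (k + r) = F \<union> vline x y r" and kr: "1 \<le> k" "1 \<le> r"
    and F: "F = vline (x + int r) (y + int r) k \<or> 2 \<le> r \<and> F = hline (x + int r) (y + int r) k"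
    and short: "shortest_merge S F (vline x y r) m S' F'"
  shows "segment x y (k + r) (F' \<union> vline x y r) \<and> m \<le> 3 * (k + r)"
proof -
  let ?T = "vline x y r"
  have ver: "m \<le> k * r" "m \<le> 3 * k + r - 3" if "F = vline (x + int r) (y + int r) k"
    using merge_path_vertical[OF S kr that] short by (auto intro: shortest_merge_le)
  have hor: "m \<le> 2 * k + r - 2" if "F = hline (x + int r) (y + int r) k"
    using merge_path_horizontal[OF S kr that] short by (auto intro: shortest_merge_le)
  have FS: "F \<subseteq> S" "finite F" "card F = k" using S F by auto
  have moves: "(free_move ^^ m) (S, F) (S', F')" and lines: "is_line F'" "is_line (F' \<union> ?T)"
    using short by (auto simp: shortest_merge_def merge_path_def)
  from free_moves_invariant[OF moves FS(1,2)]
  have F': "S' - F' = S - F" "finite F'" "card F' = k" using FS by auto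
  have "?T \<subseteq> S" using S by auto
  moreover have "F \<inter> ?T = {}" using F kr by auto
  ultimately have disj: "F' \<inter> ?T = {}" using F' by blast
  then have card: "card (F' \<union> ?T) = k + r" using F' by (simp add: card_Un_disjoint)
  obtain l rr u d where lrud: "l + rr + u + d = m" and disp: "displaced l rr u d F F'"
    using free_moves_displaced[OF moves] .
  have "(x, y) \<in> ?T" "(x, y + int r - 1) \<in> ?T" using kr by auto
  then have T: "(x, y) \<in> F' \<union> ?T" "(x, y + int r - 1) \<in> F' \<union> ?T" by blast+
  obtain a b where ab: "F' \<union> ?T = vline a b (k + r) \<or> F' \<union> ?T = hline a b (k + r)"
    using lines(2) card unfolding is_line_def by (metis card_hline card_vline)
  then show ?thesis
  proof
    assume U: "F' \<union> ?T = vline a b (k + r)"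
    have b: "a = x" "b \<le> y" "y \<le> b + int k" using T unfolding U by auto
    have F'_eq: "F' = vline x b (k + r) - ?T" using U disj b by auto
    show ?thesis
    proof (cases "b = y")
      case True
      then show ?thesis using U b ver hor F by (auto simp: segment_def)
    next
      case False
      \<comment> \<open>Otherwise \<open>F'\<close> has cells on both sides of \<open>?T\<close> and
        is not a line.\<close>
      have "b = y - int k"
      proof (rule ccontr)
        assume "b \<noteq> y - int k"
        then have "(x, b) \<in> F'" "(x, b + int (k + r) - 1) \<in> F'" "(x, y) \<notin> F'"
          unfolding F'_eq using b False kr by auto
        with lines(1) b False kr show False unfolding is_line_def by auto
      qed
      then have F'_below: "F' = vline x (y - int k) k" unfolding F'_eq by auto
      from F show ?thesis
      proof
        assume v: "F = vline (x + int r) (y + int r) k"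
        show ?thesis
        proof (cases "r = 1")
          case True
          \<comment> \<open>The top node is in row \<open>y + k\<close> and has to get below row
            \<open>y\<close>, which exceeds the \<open>k\<close> moves of the node-by-node
            path.\<close>
          have "(x + int r, y + int r + int k - 1) \<in> F" unfolding v using kr by simp
          then obtain c where "c \<in> F'" "near l rr u d (x + int r, y + int r + int k - 1) c"
            using disp unfolding displaced_def by blast
          then have "k + 1 \<le> d" using True unfolding F'_below by (cases c) (auto simp: near_def)
          with ver(1)[OF v] True lrud show ?thesis by simp
        next
          case False
          \<comment> \<open>The columns of \<open>F\<close> and \<open>F'\<close> are
            \<open>s + 2\<close> apart, as the counting bound requires. Its value
            \<open>3 * k + s\<close> is one more than the two-turn path.\<close>
          then obtain s where s: "r = s + 2" using kr that[of "r - 2"] by simp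
          have "3 * k + s \<le> m"
          proof (rule column_to_column_bound[OF moves FS(1,2)])
            show "F = {x + int s + 2} \<times> {y + int r..<y + int r + int k}"
              unfolding v s by auto
            show "F' = {x} \<times> {y - int k..<y}" unfolding F'_below by auto
          qed (use kr in auto)
          with ver(2)[OF v] s kr show ?thesis by simp
        qed
      next
        assume h: "2 \<le> r \<and> F = hline (x + int r) (y + int r) k"
        \<comment> \<open>The rightmost node needs \<open>r + k - 1\<close> units to the left and
          the lowest cell of \<open>F'\<close> needs \<open>r + k\<close> units down, together more
          than \<open>2 * k + r - 2\<close>.\<close>
        have "(x + int r + int k - 1, y + int r) \<in> F" using h kr by simp
        then obtain c where "c \<in> F'" "near l rr u d (x + int r + int k - 1, y + int r) c"
          using disp unfolding displaced_def by blast
        then have "r + k - 1 \<le> l" unfolding F'_below by (cases c) (auto simp: near_def)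
        moreover have "(x, y - int k) \<in> F'" unfolding F'_below using kr by simp
        then obtain c where "c \<in> F" "near l rr u d c (x, y - int k)"
          using disp unfolding displaced_def by blast
        then have "r + k \<le> d" using h by (cases c) (auto simp: near_def)
        ultimately show ?thesis using hor h lrud kr by simp
      qed
    qed
  next
    assume U: "F' \<union> ?T = hline a b (k + r)"
    \<comment> \<open>Both ends of the column \<open>?T\<close> lie in one row.\<close>
    have r: "r = 1" and a: "b = y" "a \<le> x" using T kr unfolding U by auto
    then have v: "F = vline (x + int r) (y + int r) k" using F by simp
    show ?thesis
    proof (cases "a = x")
      case True
      then show ?thesis using U a ver v by (auto simp: segment_def)
    next
      case False
      \<comment> \<open>This cell is at least two columns left of \<open>F\<close>, and the top node
        of \<open>F\<close> still has to come down \<open>k\<close> rows. That excludes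
        \<open>F'\<close> left of \<open>?T\<close> as well as on both sides of it.\<close>
      have "(a, y) \<in> F' \<union> ?T" unfolding U using a kr by simp
      then have "(a, y) \<in> F'" using False by simp
      then obtain c where "c \<in> F" "near l rr u d c (a, y)"
        using disp unfolding displaced_def by blast
      then have "2 \<le> l" using r a False unfolding v by (cases c) (auto simp: near_def)
      moreover have "(x + int r, y + int r + int k - 1) \<in> F" unfolding v using kr by simp
      then obtain c where c: "c \<in> F'" "near l rr u d (x + int r, y + int r + int k - 1) c"
        using disp unfolding displaced_def by blast
      then have "c \<in> hline a b (k + r)" using U by blast
      then have "k \<le> d" using c r a by (cases c) (auto simp: near_def)
      ultimately show ?thesis using ver(1)[OF v] r lrud by simp
    qed
  qed
qed

lemma shortest_merge_vertical_exists:
  assumes "S \<inter> box x y (k + r) = F \<union> vline x y r" "1 \<le> k" "1 \<le> r"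
    and "segment (x + int r) (y + int r) k F"
  shows "\<exists>m S' F'. shortest_merge S F (vline x y r) m S' F'"
  using assms(4) merge_path_imp_shortest[OF merge_path_vertical(1)[OF assms(1-3)]]
    merge_path_imp_shortest[OF merge_path_horizontal[OF assms(1-3)]]
  unfolding segment_def by blast

subsection \<open>Exchanging rows and columns\<close>

abbreviation flip :: "cell set \<Rightarrow> cell set" where
  "flip \<equiv> (`) prod.swap"

lemma mem_flip [simp]: "(p, q) \<in> flip A \<longleftrightarrow> (q, p) \<in> A"
  by (force simp: image_iff)

lemma flip_eqI: "(\<And>p q. (q, p) \<in> A \<longleftrightarrow> (p, q) \<in> B) \<Longrightarrow> flip A = B"
  by (rule set_eqI) (metis mem_flip surj_pair)

lemma flip_flip: "flip (flip A) = A"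
  by (simp add: image_image)

lemma flip_hline [simp]: "flip (hline x y k) = vline y x k"
  by (rule flip_eqI) auto

lemma flip_vline [simp]: "flip (vline x y k) = hline y x k"
  by (rule flip_eqI) auto

lemma flip_box: "flip (box x y k) = box y x k"
  by (rule flip_eqI) auto

lemma flip_Diff: "flip (A - B) = flip A - flip B"
  by (rule flip_eqI) auto

lemma is_line_flip: "is_line L \<Longrightarrow> is_line (flip L)"
  unfolding is_line_def by (metis flip_hline flip_vline)

lemma line_step_flip:
  assumes "line_step S L L'"
  shows "line_step (flip S) (flip L) (flip L')"
  using assms
proof cases
  case (right k x y)
  then show ?thesis
    using image_mono[of "hline x y k" S prod.swap] by (simp add: line_step.up)
next
  case (left k x y)
  then show ?thesis
    using image_mono[of "hline x y k" S prod.swap] by (simp add: line_step.down)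
next
  case (up k x y)
  then show ?thesis
    using image_mono[of "vline x y k" S prod.swap] by (simp add: line_step.right)
next
  case (down k x y)
  then show ?thesis
    using image_mono[of "vline x y k" S prod.swap] by (simp add: line_step.left)
qed

lemma free_move_flip:
  assumes "free_move (S, F) (S', F')"
  shows "free_move (flip S, flip F) (flip S', flip F')"
proof -
  from assms obtain L L' where "line_step S L L'" "L \<subseteq> F"
    "S' = (S - L) \<union> L'" "F' = (F - L) \<union> L'"
    by (auto simp: free_move_iff)
  then show ?thesis
    unfolding free_move_iff
    by (intro exI[of _ "flip L"] exI[of _ "flip L'"])
      (simp add: line_step_flip image_mono image_Un flip_Diff)
qed

lemma free_moves_flip:
  "(free_move ^^ m) (S, F) (S', F') \<Longrightarrow>
     (free_move ^^ m) (flip S, flip F) (flip S', flip F')"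
  by (induction m arbitrary: S' F') (auto dest: free_move_flip)

lemma merge_path_flip:
  "merge_path S F T m S' F' \<Longrightarrow> merge_path (flip S) (flip F) (flip T) m (flip S') (flip F')"
  unfolding merge_path_def image_Un[symmetric] using free_moves_flip is_line_flip by blast

text \<open>\<open>flip\<close> is an involution, so a shorter path for the flipped data would flip
  back to a shorter one for the original.\<close>

lemma shortest_merge_flip:
  assumes "shortest_merge S F T m S' F'"
  shows "shortest_merge (flip S) (flip F) (flip T) m (flip S') (flip F')"
  using assms merge_path_flip flip_flip unfolding shortest_merge_def by metis

lemma segment_flip: "segment x y k L \<Longrightarrow> segment y x k (flip L)"
  by (auto simp: segment_def)

lemma shortest_merge_segments:
  assumes S: "S \<inter> box x y (k + r) = F \<union> T" and kr: "1 \<le> k" "1 \<le> r"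
    and F: "segment (x + int r) (y + int r) k F" and T: "segment x y r T"
  shows "\<exists>m S' F'. shortest_merge S F T m S' F'"
    and "shortest_merge S F T m S' F' \<Longrightarrow> segment x y (k + r) (F' \<union> T) \<and> m \<le> 3 * (k + r)"
proof -
  have Sflip: "flip S \<inter> box y x (k + r) = flip F \<union> flip T"
    using S by (metis flip_box image_Un image_Int inj_swap)
  show "\<exists>m S' F'. shortest_merge S F T m S' F'"
  proof (cases "T = vline x y r")
    case True
    then show ?thesis using shortest_merge_vertical_exists S kr F by blast
  next
    case False
    then have "flip T = vline y x r" using T by (auto simp: segment_def)
    then have "\<exists>m S' F'. shortest_merge (flip S) (flip F) (flip T) m S' F'"
      using shortest_merge_vertical_exists Sflip kr segment_flip[OF F] by metis
    then show ?thesis using shortest_merge_flip flip_flip by metis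
  qed
  assume short: "shortest_merge S F T m S' F'"
  \<comment> \<open>If \<open>r = 1\<close>, \<open>T\<close> has both orientations and the axes are
    chosen to make \<open>F\<close> vertical; if \<open>r \<ge> 2\<close>, they are chosen to make
    \<open>T\<close> vertical.\<close>
  consider "T = vline x y r" "F = vline (x + int r) (y + int r) k \<or>
      2 \<le> r \<and> F = hline (x + int r) (y + int r) k"
    | "flip T = vline y x r" "flip F = vline (y + int r) (x + int r) k \<or>
      2 \<le> r \<and> flip F = hline (y + int r) (x + int r) k"
  proof (cases "r = 1")
    case True
    then have "T = vline x y r" "flip T = vline y x r"
      using T by (auto simp: segment_def hline_1 vline_1)
    then show ?thesis using F that by (auto simp: segment_def)
  next
    case False
    then have "2 \<le> r" using kr by simp
    show ?thesis
    proof (cases "T = vline x y r")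
      case True
      then show ?thesis using F \<open>2 \<le> r\<close> that(1) by (auto simp: segment_def)
    next
      case False
      then show ?thesis using F T \<open>2 \<le> r\<close> that(2) by (auto simp: segment_def)
    qed
  qed
  then show "segment x y (k + r) (F' \<union> T) \<and> m \<le> 3 * (k + r)"
  proof cases
    case 1
    then show ?thesis using shortest_merge_vertical[of S x y k r F m S' F'] S kr short by simp
  next
    case 2
    have "segment y x (k + r) (flip F' \<union> flip T) \<and> m \<le> 3 * (k + r)"
      using shortest_merge_vertical[of "flip S" y x k r "flip F" m "flip S'" "flip F'"]
        Sflip kr 2 shortest_merge_flip[OF short] by simp
    then show ?thesis
      using segment_flip[of y x "k + r" "flip F' \<union> flip T"] by (simp add: image_Un flip_flip)
  qed
qed

subsection \<open>Phases\<close>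

text \<open>The invariant between phases. Blocks are peeled off at the top-right end, so that the
  tail keeps the corner \<open>(x, y)\<close>. Their lengths may differ, as the number of lines may
  become odd.\<close>

fun staircase :: "int \<Rightarrow> int \<Rightarrow> nat \<Rightarrow> cell set list \<Rightarrow> bool" where
  "staircase x y n [] \<longleftrightarrow> n = 0"
| "staircase x y n (L # Ls) \<longleftrightarrow> (\<exists>k m. n = m + k \<and> 1 \<le> k \<and>
     segment (x + int m) (y + int m) k L \<and> staircase x y m Ls)"

lemma staircase_subset_box: "staircase x y n Ls \<Longrightarrow> \<Union> (set Ls) \<subseteq> box x y n"
proof (induction Ls arbitrary: n)
  case (Cons L Ls)
  then obtain k m where *: "n = m + k" "segment (x + int m) (y + int m) k L" "staircase x y m Ls"
    by auto
  have "L \<subseteq> box x y n" using segment_subset_box[OF *(2)] *(1) by fastforce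
  moreover have "box x y m \<subseteq> box x y n" using *(1) by auto
  ultimately show ?case using Cons.IH[OF *(3)] by auto
qed simp

lemma staircase_diagonal_lines: "staircase x y n (diagonal_lines x y n)"
proof (induction n)
  case (Suc n)
  have eq: "diagonal_lines x y (Suc n) = {(x + int n, y + int n)} # diagonal_lines x y n"
    by (simp add: diagonal_lines_def)
  have "segment (x + int n) (y + int n) 1 {(x + int n, y + int n)}"
    by (simp add: segment_def hline_1)
  with Suc show ?case
    unfolding eq staircase.simps by - (rule exI[of _ 1], rule exI[of _ n], simp)
qed (simp add: diagonal_lines_def)

lemma Union_diagonal_lines: "\<Union> (set (diagonal_lines x y n)) = diagonal x y n"
  by (auto simp: diagonal_lines_def diagonal_def)

lemma staircase_ConsE:
  assumes "staircase x y n (L # Ls)"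
  obtains k m where "n = m + k" "1 \<le> k" "segment (x + int m) (y + int m) k L" "staircase x y m Ls"
  using assms by auto

lemma staircase_Cons2E:
  assumes "staircase x y n (F # T # Ls)"
  obtains k r m where "n = m + r + k" "1 \<le> k" "1 \<le> r"
    "segment (x + int m + int r) (y + int m + int r) k F" "segment (x + int m) (y + int m) r T"
    "staircase x y m Ls"
  using assms by (elim staircase_ConsE) (auto simp: add.assoc)

text \<open>Only the part of the shape inside \<open>box x y n\<close> is prescribed, since lines
  merged earlier in the phase lie outside. The shape \<open>S'\<close> is described separately
  inside and outside \<open>box x y m\<close>, so that the next pair meets the same
  hypothesis.\<close>

lemma staircase_merge:
  assumes n: "n = m + r + k" and kr: "1 \<le> k" "1 \<le> r"
    and F: "segment (x + int m + int r) (y + int m + int r) k F"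
    and T: "segment (x + int m) (y + int m) r T" and Ls: "staircase x y m Ls"
    and S: "S \<inter> box x y n = \<Union> (set (F # T # Ls))"
  shows "\<exists>c S' F'. shortest_merge S F T c S' F'"
    and "shortest_merge S F T c S' F' \<Longrightarrow>
       segment (x + int m) (y + int m) (k + r) (F' \<union> T) \<and> c \<le> 3 * (k + r) \<and>
       S' \<inter> box x y m = \<Union> (set Ls) \<and>
       S' - box x y m = (S - box x y n) \<union> (F' \<union> T) \<and> (line_move ^^ c) S S'"
proof -
  let ?B = "box (x + int m) (y + int m) (k + r)"
  have sub: "?B \<subseteq> box x y n" "?B \<inter> box x y m = {}" "box x y m \<subseteq> box x y n"
    using n by auto
  have FT: "F \<subseteq> ?B" "T \<subseteq> ?B" "F \<inter> T = {}"
    using segment_subset_box[OF F] segment_subset_box[OF T] by fastforce+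
  note LsB = staircase_subset_box[OF Ls]
  have S_eq: "S \<inter> box x y n = F \<union> T \<union> \<Union> (set Ls)" using S by (simp add: Un_assoc)
  have SB: "S \<inter> ?B = F \<union> T" using S_eq sub FT LsB by blast
  note merge = shortest_merge_segments[OF SB kr F T]
  show "\<exists>c S' F'. shortest_merge S F T c S' F'" by (rule merge(1))
  assume short: "shortest_merge S F T c S' F'"
  note seg = merge(2)[OF short]
  have "(free_move ^^ c) (S, F) (S', F')"
    using short by (simp add: shortest_merge_def merge_path_def)
  moreover have "F \<subseteq> S" using SB by blast
  ultimately have inv: "F' \<subseteq> S'" "S' - F' = S - F" "(line_move ^^ c) S S'"
    using free_moves_invariant segment_finite[OF F] by blast+
  have F'B: "F' \<subseteq> ?B" using seg segment_subset_box by blast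
  have "S' = (S - F) \<union> F'" using inv by blast
  then have "S' \<inter> box x y m = \<Union> (set Ls)" "S' - box x y m = (S - box x y n) \<union> (F' \<union> T)"
    using S_eq sub FT F'B LsB by blast+
  with seg inv show "segment (x + int m) (y + int m) (k + r) (F' \<union> T) \<and> c \<le> 3 * (k + r) \<and>
      S' \<inter> box x y m = \<Union> (set Ls) \<and>
      S' - box x y m = (S - box x y n) \<union> (F' \<union> T) \<and> (line_move ^^ c) S S'"
    by blast
qed

lemma dl_phase_exists:
  assumes "staircase x y n Ls" "S \<inter> box x y n = \<Union> (set Ls)"
  shows "\<exists>c S' Ls'. dl_phase S Ls c S' Ls'"
  using assms
proof (induction Ls arbitrary: S n rule: induct_list012)
  case 1
  show ?case using dl_phase.none by blast
next
  case (2 L)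
  show ?case using dl_phase.unpaired by blast
next
  case (3 F T Ls)
  from staircase_Cons2E[OF 3(3)] obtain k r m where *: "n = m + r + k" "1 \<le> k" "1 \<le> r"
    "segment (x + int m + int r) (y + int m + int r) k F" "segment (x + int m) (y + int m) r T"
    "staircase x y m Ls" .
  note merge = staircase_merge[OF * 3(4)]
  obtain c S1 F' where short: "shortest_merge S F T c S1 F'" using merge(1) by blast
  with merge(2) have "S1 \<inter> box x y m = \<Union> (set Ls)" by blast
  from 3(1)[OF *(6) this] obtain c' S2 Ls' where "dl_phase S1 Ls c' S2 Ls'" by blast
  from dl_phase.pair[OF short this] show ?case by blast
qed

text \<open>The blocks are disjoint parts of the diagonal, so the bounds \<open>3 * (k + r)\<close>
  of the merges sum to at most \<open>3 * n\<close>.\<close>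

lemma dl_phase_staircase:
  assumes "dl_phase S Ls c S' Ls'" "staircase x y n Ls" "S \<inter> box x y n = \<Union> (set Ls)"
  shows "staircase x y n Ls' \<and> S' = (S - box x y n) \<union> \<Union> (set Ls') \<and>
    (line_move ^^ c) S S' \<and> c \<le> 3 * n \<and> length Ls' = (length Ls + 1) div 2"
  using assms
proof (induction arbitrary: n rule: dl_phase.induct)
  case (none S)
  then show ?case by auto
next
  case (unpaired S L)
  then show ?case by auto
next
  case (pair S F T m1 S1 F' Ls c S' Ls')
  from staircase_Cons2E[OF pair.prems(1)] obtain k r m where *: "n = m + r + k" "1 \<le> k" "1 \<le> r"
    "segment (x + int m + int r) (y + int m + int r) k F" "segment (x + int m) (y + int m) r T"
    "staircase x y m Ls" .
  from staircase_merge(2)[OF * pair.prems(2) pair.hyps(1)]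
  have seg: "segment (x + int m) (y + int m) (k + r) (F' \<union> T)" "m1 \<le> 3 * (k + r)"
    and S1: "S1 \<inter> box x y m = \<Union> (set Ls)" "S1 - box x y m = (S - box x y n) \<union> (F' \<union> T)"
      "(line_move ^^ m1) S S1"
    by auto
  from pair.IH[OF *(6) S1(1)] have IH: "staircase x y m Ls'"
    "S' = (S1 - box x y m) \<union> \<Union> (set Ls')" "(line_move ^^ c) S1 S'" "c \<le> 3 * m"
    "length Ls' = (length Ls + 1) div 2"
    by auto
  have "(line_move ^^ (m1 + c)) S S'" using S1(3) IH(3) by (auto simp: relpowp_add)
  moreover have "staircase x y n ((F' \<union> T) # Ls')"
    unfolding staircase.simps
    by (rule exI[of _ "k + r"], rule exI[of _ m]) (use * seg IH(1) in auto)
  moreover have "S' = (S - box x y n) \<union> \<Union> (set ((F' \<union> T) # Ls'))"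
    using IH(2) S1(2) by auto
  ultimately show ?case using * seg IH(4,5) by simp
qed

lemma dl_phases_exists:
  assumes "staircase x y n Ls"
  shows "\<exists>c S' Ls'. dl_phases p (\<Union> (set Ls)) Ls c S' Ls'"
  using assms
proof (induction p arbitrary: Ls)
  case 0
  show ?case using dl_phases.zero by blast
next
  case (Suc p)
  have B: "\<Union> (set Ls) \<inter> box x y n = \<Union> (set Ls)" "\<Union> (set Ls) - box x y n = {}"
    using staircase_subset_box[OF Suc.prems] by blast+
  obtain m S1 Ls1 where 1: "dl_phase (\<Union> (set Ls)) Ls m S1 Ls1"
    using dl_phase_exists[OF Suc.prems B(1)] by blast
  from dl_phase_staircase[OF 1 Suc.prems B(1)] B(2)
  have "staircase x y n Ls1" "S1 = \<Union> (set Ls1)" by auto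
  with Suc.IH 1 show ?case by (blast intro: dl_phases.Suc)
qed

text \<open>Halving with rounding up keeps the number of lines below the corresponding power of two,
  also when that number is odd.\<close>

lemma dl_phases_staircase:
  assumes "dl_phases p S Ls c S' Ls'" "staircase x y n Ls" "S = \<Union> (set Ls)"
  shows "staircase x y n Ls' \<and> S' = \<Union> (set Ls') \<and> (line_move ^^ c) S S' \<and> c \<le> 3 * n * p \<and>
    (length Ls \<le> 2 ^ p \<longrightarrow> length Ls' \<le> 1)"
  using assms
proof (induction rule: dl_phases.induct)
  case (zero S Ls)
  then show ?case by simp
next
  case (Suc S Ls m S1 Ls1 p c S' Ls')
  have B: "S \<inter> box x y n = \<Union> (set Ls)" "S - box x y n = {}"
    using staircase_subset_box[OF Suc.prems(1)] Suc.prems(2) by blast+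
  from dl_phase_staircase[OF Suc.hyps(1) Suc.prems(1) B(1)] B(2)
  have 1: "staircase x y n Ls1" "S1 = \<Union> (set Ls1)" "(line_move ^^ m) S S1" "m \<le> 3 * n"
    "length Ls1 = (length Ls + 1) div 2"
    by auto
  note IH = Suc.IH[OF 1(1,2)]
  have "(line_move ^^ (m + c)) S S'" using 1(3) IH by (auto simp: relpowp_add)
  then show ?case using IH 1(4,5) by auto
qed

section \<open>Number of phases and the total bound\<close>

lemma ceiling_log2_bigo:
  "(\<lambda>n. real (3 * n * nat \<lceil>log 2 (real n)\<rceil>)) \<in> O(\<lambda>n. real n * log 2 (real n))"
proof (rule bigoI[of _ 6])
  have "norm (real (3 * n * nat \<lceil>log 2 (real n)\<rceil>)) \<le> 6 * norm (real n * log 2 (real n))"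
    if "2 \<le> n" for n :: nat
  proof -
    \<comment> \<open>From \<open>n = 2\<close> on, the added 1 of rounding up is at most the
      logarithm itself; hence the constant 6, twice 3.\<close>
    have 1: "1 \<le> log 2 (real n)" using that by simp
    then have "real (nat \<lceil>log 2 (real n)\<rceil>) \<le> 2 * log 2 (real n)" by linarith
    then have "real n * real (nat \<lceil>log 2 (real n)\<rceil>) \<le> real n * (2 * log 2 (real n))"
      by (intro mult_left_mono) auto
    then show ?thesis using 1 by simp
  qed
  then show "\<forall>\<^sub>F n in at_top. norm (real (3 * n * nat \<lceil>log 2 (real n)\<rceil>))
      \<le> 6 * norm (real n * log 2 (real n))"
    using eventually_ge_at_top[of 2] by (rule eventually_mono[rotated])
qed

lemma le_two_power_ceiling_log2:
  assumes "1 \<le> n"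
  shows "n \<le> 2 ^ nat \<lceil>log 2 (real n)\<rceil>"
proof -
  have "real n = 2 powr log 2 (real n)" using assms by simp
  also have "\<dots> \<le> 2 powr real (nat \<lceil>log 2 (real n)\<rceil>)" by (intro powr_mono) linarith+
  also have "\<dots> = real (2 ^ nat \<lceil>log 2 (real n)\<rceil>)" by (simp add: powr_realpow)
  finally show ?thesis by linarith
qed

theorem theorem3p15:
  "\<exists>T :: nat \<Rightarrow> nat.
     (\<lambda>n. real (T n)) \<in> O(\<lambda>n. real n * log 2 (real n)) \<and>
     (\<forall>n \<ge> 1. \<forall>S\<^sub>D. is_diagonal n S\<^sub>D \<longrightarrow>
        (\<exists>m S\<^sub>L. DL_Doubling n S\<^sub>D m S\<^sub>L) \<and>
        (\<forall>m S\<^sub>L. DL_Doubling n S\<^sub>D m S\<^sub>L \<longrightarrow>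
           (line_move ^^ m) S\<^sub>D S\<^sub>L \<and> is_line S\<^sub>L \<and> card S\<^sub>L = n \<and> m \<le> T n))"
proof (intro exI[of _ "\<lambda>n. 3 * n * nat \<lceil>log 2 (real n)\<rceil>"] conjI allI impI)
  show "(\<lambda>n. real (3 * n * nat \<lceil>log 2 (real n)\<rceil>)) \<in> O(\<lambda>n. real n * log 2 (real n))"
    by (rule ceiling_log2_bigo)
  fix n :: nat and S\<^sub>D :: shape
  assume n: "1 \<le> n" and "is_diagonal n S\<^sub>D"
  then obtain x y where "S\<^sub>D = diagonal x y n" by (auto simp: is_diagonal_def)
  then show "\<exists>m S\<^sub>L. DL_Doubling n S\<^sub>D m S\<^sub>L"
    using dl_phases_exists[OF staircase_diagonal_lines[of x y n]]
    unfolding DL_Doubling_def Union_diagonal_lines by blast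
next
  fix n m :: nat and S\<^sub>D S\<^sub>L :: shape
  assume n: "1 \<le> n" and "DL_Doubling n S\<^sub>D m S\<^sub>L"
  then obtain x y Ls where S\<^sub>D: "S\<^sub>D = \<Union> (set (diagonal_lines x y n))"
    and "dl_phases (nat \<lceil>log 2 (real n)\<rceil>) S\<^sub>D (diagonal_lines x y n) m S\<^sub>L Ls"
    unfolding DL_Doubling_def Union_diagonal_lines by blast
  from dl_phases_staircase[OF this(2) staircase_diagonal_lines S\<^sub>D]
  have Ls: "staircase x y n Ls" "S\<^sub>L = \<Union> (set Ls)" "length Ls \<le> 1"
    and m: "(line_move ^^ m) S\<^sub>D S\<^sub>L" "m \<le> 3 * n * nat \<lceil>log 2 (real n)\<rceil>"
    using le_two_power_ceiling_log2[OF n] by (auto simp: diagonal_lines_def)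
  \<comment> \<open>At most one line remains, and an empty list would force
    \<open>n = 0\<close>.\<close>
  from Ls n obtain L where "Ls = [L]"
    by (cases Ls) auto
  with Ls have L: "segment x y n S\<^sub>L" by auto
  show "(line_move ^^ m) S\<^sub>D S\<^sub>L" "m \<le> 3 * n * nat \<lceil>log 2 (real n)\<rceil>"
    by (fact m)+
  show "is_line S\<^sub>L" using segment_is_line[OF L n] .
  show "card S\<^sub>L = n" using segment_card[OF L] .
qed

end
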